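(* Let $A$ be a pseudo $BL$-algebra and $F$ an interval valued fuzzy set of $A$. Then $F$ is an interval valued $(\in,\in\!\vee q)$-fuzzy implicative filter of $A$ if and only if for every interval number $\widehat t$ with $[0,0]<\widehat t\le[0.5,0.5]$, the level subset $F_{\widehat t}=\{x\in A\mid\widehat{\mu_F}(x)\ge\widehat t\}$, whenever nonempty, is an implicative filter of $A$.
   Context: A pseudo $BL$-algebra is an algebra $(A;\wedge,\vee,\odot,\rightarrow,\hookrightarrow,0,1)$ of type $(2,2,2,2,2,0,0)$ such that $(A,\wedge,\vee,0,1)$ is a bounded lattice with lattice order $\le$, $(A,\odot,1)$ is a monoid, and for all $x,y,z\in A$: (a1) $x\odot y\le z\iff x\le y\rightarrow z\iff y\le x\hookrightarrow z$; (a2) $x\wedge y=(x\rightarrow y)\odot x=x\odot(x\hookrightarrow y)$; (a3) $(x\rightarrow y)\vee(y\rightarrow x)=(x\hookrightarrow y)\vee(y\hookrightarrow x)=1$. A filter of $A$ is a nonempty $I\subseteq A$ with $x\odot y\in I$ for $x,y\in I$, and $x\in I$, $x\le y$ imply $y\in I$. A filter $I$ is implicative if for all $x,y\in A$, $(x\rightarrow y)\hookrightarrow x\in I$ implies $x\in I$, and $(x\hookrightarrow y)\rightarrow x\in I$ implies $x\in I$. An interval number is $\widehat{a}=[a^{\bot},a^{\top}]$ with $0\le a^{\bot}\le a^{\top}\le 1$; $D[0,1]$ is the set of interval numbers. $\widehat{a}\le\widehat{b}$ iff $a^{\bot}\le b^{\bot}$ and $a^{\top}\le b^{\top}$; $\widehat{a}<\widehat{b}$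 iff $\widehat{a}\le\widehat{b}$ and $\widehat{a}\ne\widehat{b}$; $\mathrm{rmin},\mathrm{rmax}$ and sums are componentwise. An interval valued fuzzy set $F$ of $A$ is a map $\widehat{\mu_F}:A\to D[0,1]$; standing assumption: for every $x\in A$, either $\widehat{\mu_F}(x)<[0.5,0.5]$ or $[0.5,0.5]\le\widehat{\mu_F}(x)$. For $x\in A$ and nonzero $\widehat t\in D[0,1]$: $U(x;\widehat t)\in F$ means $\widehat{\mu_F}(x)\ge\widehat t$; $U(x;\widehat t)\,q\,F$ means $\widehat{\mu_F}(x)+\widehat t>[1,1]$; $U(x;\widehat t)\in\!\vee q\,F$ means one of these holds. $F$ is an interval valued $(\in,\in\!\vee q)$-fuzzy filter if for all nonzero $\widehat t,\widehat r\in D[0,1]$ and $x,y\in A$: (F3) $U(x;\widehat t)\in F$ and $U(y;\widehat r)\in F$ imply $U(x\odot y;\mathrm{rmin}\{\widehat t,\widehat r\})\in\!\vee q\,F$; (F4) if $x\le y$ and $U(x;\widehat r)\in F$ then $U(y;\widehat r)\in\!\vee q\,F$. It is an interval valued $(\in,\in\!\vee q)$-fuzzy implicative filter if moreover, for all $x,y\in A$, (F13) $\widehat{\mu_F}(x)\ge\mathrm{rmin}\{\widehat{\mu_F}((x\rightarrow y)\hookrightarrow x),[0.5,0.5]\}$ and $\widehat{\mu_F}(x)\ge\mathrm{rmin}\{\widehat{\mu_F}((x\hookrightarrow y)\rightarrow x),[0.5,0.5]\}$.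
   Formalization: In (F3) and (F4) the nonzero interval numbers t, r are restricted to those comparable with [0.5,0.5]; with all t, r the "if" direction fails (two-element algebra, μ(0)=[0.9,0.9], μ(1)=[0.5,0.5], r=[0.2,0.9]). *)

theory Defs
  imports Complex_Main "HOL-Library.Product_Order" "HOL-Library.Product_Plus"
begin

text \<open>The lattice operations, the order and the bounds \<open>0\<close>, \<open>1\<close> of the algebra are those of
  class \<^class>\<open>bounded_lattice\<close>: \<open>0\<close> is \<open>bot\<close> and the monoid unit \<open>1\<close> is \<open>top\<close>.\<close>

class pseudo_BL_algebra = bounded_lattice +
  fixes mul :: "'a \<Rightarrow> 'a \<Rightarrow> 'a"  (infixl "\<odot>" 70)
    and imp :: "'a \<Rightarrow> 'a \<Rightarrow> 'a"  (infixr "\<rightarrow>" 60)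
    and imp' :: "'a \<Rightarrow> 'a \<Rightarrow> 'a"  (infixr "\<hookrightarrow>" 60)
  assumes mul_assoc: "(x \<odot> y) \<odot> z = x \<odot> (y \<odot> z)"
    and top_mul: "top \<odot> x = x"
    and mul_top: "x \<odot> top = x"
    and residuation: "x \<odot> y \<le> z \<longleftrightarrow> x \<le> y \<rightarrow> z"
    and residuation': "x \<odot> y \<le> z \<longleftrightarrow> y \<le> x \<hookrightarrow> z"
    and divisibility: "inf x y = (x \<rightarrow> y) \<odot> x"
    and divisibility': "inf x y = x \<odot> (x \<hookrightarrow> y)"
    and prelinearity: "sup (x \<rightarrow> y) (y \<rightarrow> x) = top"
    and prelinearity': "sup (x \<hookrightarrow> y) (y \<hookrightarrow> x) = top"

definition is_filter :: "'a::pseudo_BL_algebra set \<Rightarrow> bool" where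
  "is_filter I \<longleftrightarrow>
     I \<noteq> {} \<and>
     (\<forall>x\<in>I. \<forall>y\<in>I. x \<odot> y \<in> I) \<and>
     (\<forall>x y. x \<in> I \<longrightarrow> x \<le> y \<longrightarrow> y \<in> I)"

definition implicative_filter :: "'a::pseudo_BL_algebra set \<Rightarrow> bool" where
  "implicative_filter I \<longleftrightarrow>
     is_filter I \<and>
     (\<forall>x y. (x \<rightarrow> y) \<hookrightarrow> x \<in> I \<longrightarrow> x \<in> I) \<and>
     (\<forall>x y. (x \<hookrightarrow> y) \<rightarrow> x \<in> I \<longrightarrow> x \<in> I)"

text \<open>An interval \<open>[a, b]\<close> is represented by the pair of its end points, so that \<open>\<le>\<close>, \<open><\<close> and \<open>+\<close>
  are the componentwise ones of \<^theory>\<open>HOL-Library.Product_Order\<close> and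
  \<^theory>\<open>HOL-Library.Product_Plus\<close>; in particular \<open>a < b\<close> means \<open>a \<le> b \<and> a \<noteq> b\<close>.
  A sum of interval numbers may lie outside \<open>D01\<close>.\<close>

type_synonym interval = "real \<times> real"

definition D01 :: "interval set" where
  "D01 = {(a, b). 0 \<le> a \<and> a \<le> b \<and> b \<le> 1}"

definition rmin :: "interval \<Rightarrow> interval \<Rightarrow> interval" where
  "rmin s t = (min (fst s) (fst t), min (snd s) (snd t))"

abbreviation half :: interval where
  "half \<equiv> (1/2, 1/2)"

text \<open>The second conjunct is the standing assumption made on all interval valued fuzzy sets.\<close>

definition interval_fuzzy_set :: "('a \<Rightarrow> interval) \<Rightarrow> bool" where
  "interval_fuzzy_set F \<longleftrightarrow>
     (\<forall>x. F x \<in> D01) \<and> (\<forall>x. F x < half \<or> half \<le> F x)"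

text \<open>\<open>U(x;t)\<close> is the interval valued fuzzy set with value \<open>t\<close> at \<open>x\<close> and \<open>[0,0]\<close> elsewhere, where
  \<open>t \<noteq> [0,0]\<close>. Being an interval valued fuzzy set, it obeys the standing assumption, so \<open>t\<close> is
  comparable with \<open>[0.5,0.5]\<close>. This matters: if values such as \<open>t = [0.2,0.9]\<close> were admitted,
  then on the two-element algebra the map \<open>0 \<mapsto> [0.9,0.9]\<close>, \<open>1 \<mapsto> [0.5,0.5]\<close> would violate the
  second condition of \<open>in_invq_fuzzy_filter\<close>, although each of its level sets for
  \<open>t \<le> [0.5,0.5]\<close> is the whole algebra.\<close>

definition fuzzy_point :: "'a \<Rightarrow> interval \<Rightarrow> 'a \<Rightarrow> interval" where
  "fuzzy_point x t = (\<lambda>y. if y = x then t else (0, 0))"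

definition is_fuzzy_point :: "'a \<Rightarrow> interval \<Rightarrow> bool" where
  "is_fuzzy_point x t \<longleftrightarrow> t \<noteq> (0, 0) \<and> interval_fuzzy_set (fuzzy_point x t)"

definition point_in :: "'a \<Rightarrow> interval \<Rightarrow> ('a \<Rightarrow> interval) \<Rightarrow> bool" where
  "point_in x t F \<longleftrightarrow> F x \<ge> t"

definition point_q :: "'a \<Rightarrow> interval \<Rightarrow> ('a \<Rightarrow> interval) \<Rightarrow> bool" where
  "point_q x t F \<longleftrightarrow> F x + t > (1, 1)"

definition point_invq :: "'a \<Rightarrow> interval \<Rightarrow> ('a \<Rightarrow> interval) \<Rightarrow> bool" where
  "point_invq x t F \<longleftrightarrow> point_in x t F \<or> point_q x t F"

definition in_invq_fuzzy_filter :: "('a::pseudo_BL_algebra \<Rightarrow> interval) \<Rightarrow> bool" where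
  "in_invq_fuzzy_filter F \<longleftrightarrow>
     (\<forall>x y t r. is_fuzzy_point x t \<longrightarrow> is_fuzzy_point y r \<longrightarrow>
        point_in x t F \<longrightarrow> point_in y r F \<longrightarrow> point_invq (x \<odot> y) (rmin t r) F) \<and>
     (\<forall>x y r. is_fuzzy_point x r \<longrightarrow>
        x \<le> y \<longrightarrow> point_in x r F \<longrightarrow> point_invq y r F)"

definition in_invq_fuzzy_implicative_filter :: "('a::pseudo_BL_algebra \<Rightarrow> interval) \<Rightarrow> bool" where
  "in_invq_fuzzy_implicative_filter F \<longleftrightarrow>
     in_invq_fuzzy_filter F \<and>
     (\<forall>x y. F x \<ge> rmin (F ((x \<rightarrow> y) \<hookrightarrow> x)) half) \<and>
     (\<forall>x y. F x \<ge> rmin (F ((x \<hookrightarrow> y) \<rightarrow> x)) half)"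

definition level_subset :: "('a \<Rightarrow> interval) \<Rightarrow> interval \<Rightarrow> 'a set" where
  "level_subset F t = {x. F x \<ge> t}"

end

theory Submission
  imports Defs
begin

text \<open>For \<open>t \<le> [0.5,0.5]\<close> the relation \<open>U(x;t) \<in>\<or>q F\<close> collapses to \<open>F x \<ge> t\<close>, because
  \<open>F x + t > [1,1]\<close> already forces \<open>F x \<ge> [0.5,0.5]\<close>. Conversely, \<open>F x \<ge> [0.5,0.5]\<close> yields
  \<open>U(x;t) \<in>\<or>q F\<close> for every \<open>t \<ge> [0.5,0.5]\<close>. Since the values of fuzzy points are comparable with
  \<open>[0.5,0.5]\<close>, the fuzzy conditions only depend on the level subsets for \<open>t \<le> [0.5,0.5]\<close>.\<close>

lemma D01_iff: "t \<in> D01 \<longleftrightarrow> 0 \<le> fst t \<and> fst t \<le> snd t \<and> snd t \<le> 1"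
  by (cases t) (simp add: D01_def)

lemma D01_pos_iff: "t \<in> D01 \<Longrightarrow> (0, 0) < t \<longleftrightarrow> t \<noteq> (0, 0)"
  by (cases t) (auto simp: D01_def less_le)

lemma rmin_le: "rmin s t \<le> s" "rmin s t \<le> t"
  by (simp_all add: rmin_def less_eq_prod_def)

lemma le_rmin_iff: "u \<le> rmin s t \<longleftrightarrow> u \<le> s \<and> u \<le> t"
  by (auto simp: rmin_def less_eq_prod_def)

lemma rmin_D01: "s \<in> D01 \<Longrightarrow> t \<in> D01 \<Longrightarrow> rmin s t \<in> D01"
  by (auto simp: D01_iff rmin_def)

lemma half_D01: "half \<in> D01"
  by (simp add: D01_def)

text \<open>The hypotheses say that both upper end points are positive.\<close>
lemma rmin_nonzero:
  assumes "s \<in> D01" "t \<in> D01" "s \<noteq> (0, 0)" "t \<noteq> (0, 0)"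
  shows "rmin s t \<noteq> (0, 0)"
  using assms by (cases s; cases t) (auto simp: D01_def rmin_def min_def split: if_splits)

text \<open>Away from \<open>x\<close> the fuzzy point takes the value \<open>(0, 0)\<close>, which
  lies in \<open>D01\<close> and below \<open>half\<close>, so only the value \<open>t\<close> at
  \<open>x\<close> is constrained.\<close>

lemma is_fuzzy_point_iff:
  "is_fuzzy_point x t \<longleftrightarrow> t \<in> D01 \<and> t \<noteq> (0, 0) \<and> (t \<le> half \<or> half \<le> t)"
proof -
  have "((0, 0) :: interval) < half" "((0, 0) :: interval) \<in> D01"
    by (simp_all add: less_le D01_def)
  moreover have "t < half \<or> half \<le> t \<longleftrightarrow> t \<le> half \<or> half \<le> t"
    by (auto simp: less_le)
  ultimately show ?thesis
    unfolding is_fuzzy_point_def interval_fuzzy_set_def fuzzy_point_def by auto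
qed

lemma point_invq_iff_point_in:
  assumes "t \<le> half"
  shows "point_invq x t F \<longleftrightarrow> point_in x t F"
proof -
  have "point_in x t F" if "point_q x t F"
    using that assms
    by (cases "F x"; cases t) (auto simp: point_q_def point_in_def less_le)
  then show ?thesis
    by (auto simp: point_invq_def)
qed

lemma point_invq_ge_half:
  assumes "half \<le> t" "half \<le> F x"
  shows "point_invq x t F"
\<comment> \<open>The relation \<open>point_q\<close> is strict: for \<open>F x = t = half\<close>
  the sum is exactly \<open>(1, 1)\<close>, and only \<open>point_in\<close> holds.\<close>
proof (cases "t = half")
  case True
  with assms show ?thesis by (simp add: point_invq_def point_in_def)
next
  case False
  with assms have "F x + t > (1, 1)"
    by (cases "F x"; cases t) (auto simp: less_le)
  then show ?thesis by (simp add: point_invq_def point_q_def)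
qed

text \<open>By comparability \<open>rmin t half\<close> is \<open>t\<close> or \<open>half\<close>.
  Capping at \<open>half\<close> turns any admissible value into a level to which the assumption on
  level subsets applies.\<close>

lemma point_invqI:
  assumes "t \<le> half \<or> half \<le> t" "rmin t half \<le> F x"
  shows "point_invq x t F"
proof (cases "t \<le> half")
  case True
  then have "t \<le> rmin t half" by (simp add: le_rmin_iff)
  with assms(2) have "t \<le> F x" by (rule order_trans[rotated])
  then show ?thesis by (simp add: point_invq_def point_in_def)
next
  case False
  with assms(1) have t: "half \<le> t" by simp
  then have "half \<le> rmin t half" by (simp add: le_rmin_iff)
  with assms(2) have "half \<le> F x" by (rule order_trans[rotated])
  with t show ?thesis by (rule point_invq_ge_half)
qed

lemma in_invq_fuzzy_filter_iff_level_subsets: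
  "in_invq_fuzzy_filter F \<longleftrightarrow>
    (\<forall>t\<in>D01. t \<noteq> (0, 0) \<longrightarrow> t \<le> half \<longrightarrow> level_subset F t \<noteq> {} \<longrightarrow> is_filter (level_subset F t))"
  (is "_ \<longleftrightarrow> ?levels")
proof
  assume F: "in_invq_fuzzy_filter F"
  show ?levels
  proof (intro ballI impI)
    fix t :: interval
    assume t: "t \<in> D01" "t \<noteq> (0, 0)" "t \<le> half" and ne: "level_subset F t \<noteq> {}"
    have point: "is_fuzzy_point x t" for x :: 'a
      using t by (simp add: is_fuzzy_point_iff)
    have idem: "rmin t t = t" by (simp add: rmin_def)
    \<comment> \<open>Both fuzzy points are taken at the same level \<open>t\<close>, so that
      \<open>rmin\<close> returns \<open>t\<close>.\<close>
    have "t \<le> F (x \<odot> y)" if "t \<le> F x" "t \<le> F y" for x y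
      using F that point[of x] point[of y] idem point_invq_iff_point_in[OF t(3), of "x \<odot> y" F]
      unfolding in_invq_fuzzy_filter_def point_in_def by metis
    moreover have "t \<le> F y" if "t \<le> F x" "x \<le> y" for x y
      using F that point[of x] point_invq_iff_point_in[OF t(3), of y F]
      unfolding in_invq_fuzzy_filter_def point_in_def by blast
    ultimately show "is_filter (level_subset F t)"
      using ne unfolding is_filter_def level_subset_def by blast
  qed
next
  assume L: ?levels
  \<comment> \<open>The capped level stays nonzero, and \<open>x\<close> witnesses that its level
    subset is nonempty.\<close>
  have filter: "is_filter (level_subset F (rmin t half))"
    if "t \<in> D01" "t \<noteq> (0, 0)" "rmin t half \<le> F x" for t x
    using L that rmin_D01[OF that(1) half_D01] rmin_nonzero[OF that(1) half_D01 that(2)]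
      rmin_le(2)[of t half]
    by (auto simp: level_subset_def)
  show "in_invq_fuzzy_filter F"
    unfolding in_invq_fuzzy_filter_def
  proof (intro conjI allI impI)
    fix x y :: 'a and t r :: interval
    assume t: "is_fuzzy_point x t" and r: "is_fuzzy_point y r"
      and "point_in x t F" "point_in y r F"
    then have x: "rmin (rmin t r) half \<le> F x" and y: "rmin (rmin t r) half \<le> F y"
      unfolding point_in_def by (meson order_trans rmin_le)+
    have "rmin t r \<in> D01" "rmin t r \<noteq> (0, 0)"
      using t r by (auto simp: is_fuzzy_point_iff rmin_D01 rmin_nonzero)
    from filter[OF this x] x y have "rmin (rmin t r) half \<le> F (x \<odot> y)"
      by (auto simp: is_filter_def level_subset_def)
    \<comment> \<open>Comparability with \<open>half\<close> survives \<open>rmin\<close>: either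
      one argument is below \<open>half\<close>, or both are above it.\<close>
    moreover have "rmin t r \<le> half \<or> half \<le> rmin t r"
      using t r unfolding is_fuzzy_point_iff le_rmin_iff by (meson order_trans rmin_le)
    ultimately show "point_invq (x \<odot> y) (rmin t r) F"
      by (intro point_invqI)
  next
    fix x y :: 'a and r :: interval
    assume r: "is_fuzzy_point x r" and "x \<le> y" "point_in x r F"
    then have x: "rmin r half \<le> F x"
      unfolding point_in_def by (meson order_trans rmin_le)
    with filter[OF _ _ x] r \<open>x \<le> y\<close> have "rmin r half \<le> F y"
      by (auto simp: is_filter_def level_subset_def is_fuzzy_point_iff)
    with r show "point_invq y r F"
      by (intro point_invqI) (simp_all add: is_fuzzy_point_iff)
  qed
qed

text \<open>Among the levels up to \<open>half\<close>, \<open>rmin (F z) half\<close> is the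
  largest whose level subset contains \<open>z\<close>, so testing this one suffices. If it is
  \<open>(0, 0)\<close>, it is no admissible level, but the inequality is trivial.\<close>

lemma rmin_half_le_iff_level_subsets:
  assumes "F z \<in> D01" "F x \<in> D01"
  shows "rmin (F z) half \<le> F x \<longleftrightarrow>
    (\<forall>t\<in>D01. t \<noteq> (0, 0) \<longrightarrow> t \<le> half \<longrightarrow> z \<in> level_subset F t \<longrightarrow> x \<in> level_subset F t)"
proof
  assume le: "rmin (F z) half \<le> F x"
  have "t \<le> F x" if "t \<le> half" "t \<le> F z" for t
    using le that by (meson le_rmin_iff order_trans)
  then show "\<forall>t\<in>D01. t \<noteq> (0, 0) \<longrightarrow> t \<le> half \<longrightarrow> z \<in> level_subset F t \<longrightarrow> x \<in> level_subset F t"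
    by (simp add: level_subset_def)
next
  assume L: "\<forall>t\<in>D01. t \<noteq> (0, 0) \<longrightarrow> t \<le> half \<longrightarrow> z \<in> level_subset F t \<longrightarrow> x \<in> level_subset F t"
  show "rmin (F z) half \<le> F x"
  proof (cases "rmin (F z) half = (0, 0)")
    case True
    with assms(2) show ?thesis by (simp add: D01_iff less_eq_prod_def)
  next
    case False
    with L rmin_D01[OF assms(1) half_D01] show ?thesis
      by (simp add: level_subset_def rmin_le)
  qed
qed

theorem theorem4p3:
  fixes F :: "'a::pseudo_BL_algebra \<Rightarrow> interval"
  assumes "interval_fuzzy_set F"
  shows "in_invq_fuzzy_implicative_filter F \<longleftrightarrow>
    (\<forall>t\<in>D01. (0, 0) < t \<longrightarrow> t \<le> half \<longrightarrow> level_subset F t \<noteq> {} \<longrightarrow>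
       implicative_filter (level_subset F t))"
proof -
  have D: "F x \<in> D01" for x
    using assms by (simp add: interval_fuzzy_set_def)
  show ?thesis
    \<comment> \<open>All conditions are now quantified over the same levels. An element in the
      premise of an implicative condition makes the level subset nonempty, so that guard can be
      added or dropped.\<close>
    unfolding in_invq_fuzzy_implicative_filter_def in_invq_fuzzy_filter_iff_level_subsets
      rmin_half_le_iff_level_subsets[where F = F, OF D D] implicative_filter_def
    using D01_pos_iff by blast
qed

end
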